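(* Let $\mathcal{P}$ be a set of primes such that $$\sum_{p\in\mathcal{P}}p^{-1}\le 1+\bigg(1-\sum_{p\in\mathcal{P}}p^{-2}\bigg)^{1/2}.$$ Then $\mathcal{P}$ is Erdős-best among primitive subsets of $\mathbb{N}(\mathcal{P})$; that is, for every primitive set $\mathcal{S}\subset\mathbb{N}(\mathcal{P})$, $$\sum_{n\in\mathcal{S}}\frac{1}{n\log n}\le\sum_{p\in\mathcal{P}}\frac{1}{p\log p}.$$
   Context: $\mathbb{N}=\{1,2,3,\dots\}$. For a set $\mathcal{P}$ of primes (finite or infinite), $\mathbb{N}(\mathcal{P})=\{n\in\mathbb{N}: p\mid n\Rightarrow p\in\mathcal{P}\text{ for every prime }p\}$ is the set of natural numbers all of whose prime factors lie in $\mathcal{P}$. A nonempty set of natural numbers is called primitive if no element of the set divides another (distinct) element; by convention the singleton $\{1\}$ is not primitive (hence no primitive set contains $1$). Sums of nonnegative terms over possibly infinite sets are taken in $[0,\infty]$, so the hypothesis includes that $\sum_{p\in\mathcal{P}}p^{-1}$ converges. The square root is well defined because $\sum_{p}p^{-2}<1$ over all primes. *)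

theory Defs
  imports "HOL-Analysis.Analysis" "HOL-Computational_Algebra.Primes"
begin

definition nat_over :: "nat set \<Rightarrow> nat set" where
  "nat_over P = {n. n > 0 \<and> (\<forall>p. prime p \<longrightarrow> p dvd n \<longrightarrow> p \<in> P)}"

(* The natural numbers start at 1, hence "0 \<notin> S". Since 1 divides everything,
   excluding the singleton {1} already excludes every set containing 1. *)
definition primitive_set :: "nat set \<Rightarrow> bool" where
  "primitive_set S \<longleftrightarrow>
     S \<noteq> {} \<and> 0 \<notin> S \<and> S \<noteq> {1} \<and> (\<forall>a\<in>S. \<forall>b\<in>S. a dvd b \<longrightarrow> a = b)"

lemma primitive_set_not_1: "primitive_set S \<Longrightarrow> 1 \<notin> S"
  unfolding primitive_set_def by (metis one_dvd is_singletonI' is_singleton_the_elem empty_iff singletonD)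

(* The real-valued series of p^(-2) always converges, to a value below 1. So, in
   1 - (series), infsum never takes its default value 0 for divergent series, and
   sqrt is applied to a positive number. *)
lemma sum_inverse_squares_le:
  assumes "n \<ge> 2"
  shows "(\<Sum>k=2..n. 1 / real k ^ 2) \<le> 3/4 - 1 / real n"
  using assms
proof (induction n rule: dec_induct)
  case base
  show ?case by simp
next
  case (step n)
  have "1 / real (Suc n) ^ 2 \<le> 1 / real n - 1 / real (Suc n)"
  proof -
    have "1 / real n - 1 / real (Suc n) = 1 / (real n * real (Suc n))"
      using step.hyps by (simp add: field_simps)
    moreover have "1 / real (Suc n) ^ 2 \<le> 1 / (real n * real (Suc n))"
      unfolding power2_eq_square using step.hyps
      by (intro divide_left_mono mult_right_mono mult_pos_pos) auto
    ultimately show ?thesis by simp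
  qed
  with step show ?case by simp
qed

lemma sum_inverse_prime_squares:
  fixes P :: "nat set"
  assumes "\<forall>p\<in>P. prime p"
  shows "(\<lambda>p. 1 / real p ^ 2) summable_on P"
    and "(\<Sum>\<^sub>\<infinity>p\<in>P. 1 / real p ^ 2) < 1"
proof -
  have bound: "(\<Sum>p\<in>F. 1 / real p ^ 2) \<le> 3/4" if "finite F" "F \<subseteq> P" for F
  proof -
    define n where "n = Max (insert 2 F)"
    have n: "n \<ge> 2" using \<open>finite F\<close> by (simp add: n_def)
    have "F \<subseteq> {2..n}"
    proof
      fix p assume "p \<in> F"
      moreover from this have "prime p" using that assms by blast
      ultimately show "p \<in> {2..n}"
        using that(1) by (simp add: n_def prime_ge_2_nat)
    qed
    hence "(\<Sum>p\<in>F. 1 / real p ^ 2) \<le> (\<Sum>k=2..n. 1 / real k ^ 2)"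
      by (intro sum_mono2) auto
    also have "\<dots> \<le> 3/4 - 1 / real n" by (rule sum_inverse_squares_le[OF n])
    also have "\<dots> \<le> 3/4" by simp
    finally show ?thesis .
  qed
  show *: "(\<lambda>p. 1 / real p ^ 2) summable_on P"
    by (rule nonneg_bdd_above_summable_on) (auto intro!: bdd_aboveI[where M = "3/4"] bound)
  have "(\<Sum>\<^sub>\<infinity>p\<in>P. 1 / real p ^ 2) \<le> 3/4"
    by (rule infsum_le_finite_sums[OF *]) (use bound in auto)
  thus "(\<Sum>\<^sub>\<infinity>p\<in>P. 1 / real p ^ 2) < 1" by simp
qed

end

theory Submission
  imports Defs "HOL-Real_Asymp.Real_Asymp"
begin

text \<open>
  Since $1/(n\log n) = \int_1^\infty n^{-t}\,dt$, it suffices to compare the Dirichlet sums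
  $\sum_{n\in S} n^{-t} \le \sum_{p\in P} p^{-t}$ for every $t \ge 1$, and because all terms are
  nonnegative it suffices to do so for finite sets.  Writing a number as the multiset of its prime
  factors turns $n \mapsto n^{-t}$ into the multiplicative weight with $w_p = p^{-t}$, and a primitive
  set into an antichain for multiset inclusion.  The question becomes: when does no antichain of
  nonempty multisets outweigh the set of all singletons?

  Testing the antichain of all pairs shows that one needs $h_2 \le h_1$ for the complete homogeneous
  symmetric functions, that is, with $h = \sum_p w_p$,
  \[ h^2 + \sum_p w_p^2 \le 2h. \]
  This is what the hypothesis on $P$ says once squared, and it persists for all $t \ge 1$ and
  under passage to subsets of $P$.  The condition is also sufficient.  Replace the largest members
  of the antichain by their shadow, the multisets obtained from them by deleting one element; the
  result is again an antichain, as long as these members have size at least two, so what has to be shown is that the shadow weighs at least as much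
  (\<open>weight_le_weight_shadow\<close>).  For this let every multiset $M$ pay $w_p w(M) y(M,p)$ to
  $M + p$, for each $p$.  No $M$ pays more than its weight if $\sum_p w_p\, y(M,p) \le 1$
  (\<open>sum_share_le_1\<close>), and $N$ receives at least its weight if
  $\sum_{p \in N} y(N - p, p) \ge 1$ (\<open>sum_share_ge_1\<close>).  For pairs this is a fractional
  tournament problem with the solution
  \[ x_{qq} = 1, \qquad x_{qp} = \frac12 + \frac{w_p - w_q}{2h} \quad (p \ne q), \]
  and for multisets of any size it is enough to take for $y(M,p)$ the average of $x_{qp}$ over
  the elements $q$ of $M$.
\<close>

section \<open>Antichains of weighted multisets\<close>

lemma sum_mset_eq_sum_count:
  fixes f :: "'a \<Rightarrow> real"
  assumes "finite T" "set_mset M \<subseteq> T"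
  shows "(\<Sum>q\<in>#M. f q) = (\<Sum>q\<in>T. real (count M q) * f q)"
  using assms(2)
proof (induction M)
  case (add x M)
  have "(\<Sum>q\<in>T. real (count (add_mset x M) q) * f q)
      = (\<Sum>q\<in>T. (if q = x then f q else 0) + real (count M q) * f q)"
    by (intro sum.cong) (auto simp: distrib_right)
  thus ?case using add assms(1) by (simp add: sum.distrib)
qed simp

text \<open>
  The last assumption is $h_2 \le h_1$: the multisets of size two weigh no more than the singletons.
\<close>

locale pair_bounded_weights =
  fixes X :: "'a set" and w :: "'a \<Rightarrow> real"
  assumes finite_X: "finite X"
    and w_pos: "p \<in> X \<Longrightarrow> w p > 0"
    and pairs_le: "(\<Sum>p\<in>X. w p)\<^sup>2 + (\<Sum>p\<in>X. (w p)\<^sup>2) \<le> 2 * (\<Sum>p\<in>X. w p)"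
begin

definition total :: real where
  "total = (\<Sum>p\<in>X. w p)"

definition weight :: "'a multiset \<Rightarrow> real" where
  "weight M = (\<Prod>p\<in>#M. w p)"

text \<open>
  The multiset \<open>{#p, q#}\<close> has to be paid for by its two parts: \<open>{#q#}\<close> contributes the fraction
  \<open>transfer q p\<close>.  The correction to an even split makes all singletons pay the same proportion of
  their weight, namely $h_2/h_1$.
\<close>

definition transfer :: "'a \<Rightarrow> 'a \<Rightarrow> real" where
  "transfer q p = (if p = q then 1 else 1/2 + (w p - w q) / (2 * total))"

definition share :: "'a multiset \<Rightarrow> 'a \<Rightarrow> real" where
  "share M p = (\<Sum>q\<in>#M. transfer q p) / real (size M)"

definition shadow :: "'a multiset set \<Rightarrow> 'a multiset set" where
  "shadow B = (\<Union>N\<in>B. (\<lambda>p. N - {#p#}) ` set_mset N)"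

lemma w_le_total: "p \<in> X \<Longrightarrow> w p \<le> total"
  unfolding total_def using finite_X w_pos by (intro member_le_sum) (auto intro: less_imp_le)

lemma total_pos: "p \<in> X \<Longrightarrow> total > 0"
  using w_le_total[of p] w_pos[of p] by linarith

lemma weight_pos: "set_mset M \<subseteq> X \<Longrightarrow> weight M > 0"
  unfolding weight_def by (induction M) (auto intro!: mult_pos_pos w_pos)

lemma weight_nonneg: "set_mset M \<subseteq> X \<Longrightarrow> weight M \<ge> 0"
  using weight_pos[of M] by simp

lemma transfer_self [simp]: "transfer q q = 1"
  by (simp add: transfer_def)

lemma transfer_swap: "p \<noteq> q \<Longrightarrow> transfer p q + transfer q p = 1"
  by (simp add: transfer_def diff_divide_distrib)

lemma transfer_nonneg:
  assumes "q \<in> X" "p \<in> X"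
  shows "transfer q p \<ge> 0"
proof (cases "p = q")
  case False
  have "0 \<le> total + (w p - w q)"
    using w_le_total[OF assms(1)] w_pos[OF assms(2)] by linarith
  also have "total + (w p - w q) = 2 * total * transfer q p"
    using total_pos[OF assms(1)] False by (simp add: transfer_def field_simps)
  finally show ?thesis
    using total_pos[OF assms(1)] by (simp add: zero_le_mult_iff)
qed simp

lemma sum_transfer_le_1:
  assumes "q \<in> X"
  shows "(\<Sum>p\<in>X. w p * transfer q p) \<le> 1"
proof -
  note tp = total_pos[OF assms]
  \<comment> \<open>On the diagonal the formula for \<open>p \<noteq> q\<close> gives only \<open>1/2\<close>; the last summand adds the rest.\<close>
  have "(\<Sum>p\<in>X. w p * transfer q p) =
      (\<Sum>p\<in>X. w p / 2 + ((w p)\<^sup>2 - w q * w p) / (2 * total) + (if p = q then w q / 2 else 0))"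
    using tp by (intro sum.cong refl) (auto simp: transfer_def field_simps power2_eq_square)
  also have "\<dots> = total / 2 + ((\<Sum>p\<in>X. (w p)\<^sup>2) - w q * total) / (2 * total) + w q / 2"
    using finite_X assms
    by (simp add: sum.distrib sum_subtractf total_def flip: sum_divide_distrib sum_distrib_left)
  also have "\<dots> = (total\<^sup>2 + (\<Sum>p\<in>X. (w p)\<^sup>2)) / (2 * total)"
    using tp by (simp add: field_simps power2_eq_square)
  also have "\<dots> \<le> 1"
    using tp pairs_le by (simp add: total_def)
  finally show ?thesis .
qed

lemma share_nonneg:
  assumes "set_mset M \<subseteq> X" "p \<in> X"
  shows "share M p \<ge> 0"
proof -
  have "(\<Sum>q\<in>#M. transfer q p) \<ge> 0"
    using assms(1) by (induction M) (use assms(2) transfer_nonneg in \<open>auto intro!: add_nonneg_nonneg\<close>)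
  thus ?thesis by (simp add: share_def)
qed

lemma sum_share_le_1:
  assumes "set_mset M \<subseteq> X"
  shows "(\<Sum>p\<in>X. w p * share M p) \<le> 1"
proof -
  have "(\<Sum>p\<in>X. w p * (\<Sum>q\<in>#M. transfer q p)) \<le> real (size M)"
    using assms
  proof (induction M)
    case (add q M)
    thus ?case
      using sum_transfer_le_1[of q] by (simp add: distrib_left sum.distrib)
  qed simp
  moreover have "(\<Sum>p\<in>X. w p * share M p) = (\<Sum>p\<in>X. w p * (\<Sum>q\<in>#M. transfer q p)) / real (size M)"
    by (simp add: share_def sum_divide_distrib)
  ultimately show ?thesis
    by (cases "M = {#}") (simp_all add: divide_le_eq)
qed

text \<open>
  Let $N$ have size $k$ and $s$ distinct elements.  Up to the factor $1/(k-1)$, the sum runs over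
  the ordered pairs $(q,p)$ with $p$ in the support of $N$ and $q$ in $N - p$.  The diagonal pairs
  contribute $k - s$, and, since opposite transfers add up to one, the others contribute at least
  ${s \choose 2} \ge s - 1$.
\<close>

lemma sum_share_ge_1:
  assumes "set_mset N \<subseteq> X" "size N \<ge> 2"
  shows "(\<Sum>p\<in>set_mset N. share (N - {#p#}) p) \<ge> 1"
proof -
  define T where "T = set_mset N"
  define s where "s = real (card T)"
  have [simp]: "finite T" by (simp add: T_def)
  have "(\<Sum>p\<in>T. \<Sum>q\<in>T. transfer q p) + (\<Sum>p\<in>T. \<Sum>q\<in>T. transfer q p)
      = (\<Sum>p\<in>T. \<Sum>q\<in>T. transfer q p) + (\<Sum>p\<in>T. \<Sum>q\<in>T. transfer p q)"
    by (subst (2) sum.swap) simp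
  also have "\<dots> = (\<Sum>p\<in>T. \<Sum>q\<in>T. transfer q p + transfer p q)"
    by (simp add: sum.distrib)
  also have "\<dots> = (\<Sum>p\<in>T. \<Sum>q\<in>T. 1 + (if q = p then 1 else 0))"
    using transfer_swap by (intro sum.cong refl) auto
  also have "\<dots> = s * s + s"
    by (simp add: sum.distrib s_def distrib_left)
  finally have double: "(\<Sum>p\<in>T. \<Sum>q\<in>T. transfer q p) = (s * s + s) / 2"
    by simp
  have "(card T = 1 \<or> card T \<ge> 2)"
    using assms by (cases "card T") (auto simp: T_def)
  hence "(s - 1) * (s - 2) \<ge> 0"
    by (auto simp: s_def)
  hence "real (size N) - 1 \<le> (s * s + s) / 2 + (real (size N) - 2 * s)"
    by (simp add: field_simps)
  also have "\<dots> = (\<Sum>p\<in>T. \<Sum>q\<in>T. transfer q p + (if q = p then real (count N p) - 2 else 0))"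
    by (simp add: sum.distrib sum_subtractf double s_def size_multiset_overloaded_eq flip: T_def)
  also have "\<dots> \<le> (\<Sum>p\<in>T. \<Sum>q\<in>T. real (count (N - {#p#}) q) * transfer q p)"
  proof (intro sum_mono)
    fix p q assume pq: "p \<in> T" "q \<in> T"
    hence c: "count N q \<ge> 1" by (simp add: T_def)
    show "transfer q p + (if q = p then real (count N p) - 2 else 0)
          \<le> real (count (N - {#p#}) q) * transfer q p"
    proof (cases "q = p")
      case False
      have "1 * transfer q p \<le> real (count N q) * transfer q p"
        using c pq assms(1) by (intro mult_right_mono transfer_nonneg) (auto simp: T_def)
      thus ?thesis using False by simp
    qed (use c in \<open>simp add: of_nat_diff\<close>)
  qed
  also have "\<dots> = (\<Sum>p\<in>T. \<Sum>q\<in>#N - {#p#}. transfer q p)"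
    by (intro sum.cong refl sum_mset_eq_sum_count [symmetric])
       (auto simp: T_def dest: in_diffD)
  also have "\<dots> = (real (size N) - 1) * (\<Sum>p\<in>T. share (N - {#p#}) p)"
    unfolding sum_distrib_left share_def using assms(2)
    by (intro sum.cong refl) (auto simp: T_def size_Diff_singleton of_nat_diff)
  finally show ?thesis
    using assms(2) by (simp add: T_def)
qed

lemma weight_le_weight_shadow:
  assumes "finite B" and B: "\<And>N. N \<in> B \<Longrightarrow> set_mset N \<subseteq> X \<and> size N \<ge> 2"
  shows "(\<Sum>N\<in>B. weight N) \<le> (\<Sum>M\<in>shadow B. weight M)"
proof -
  define pay where "pay = (\<lambda>(M, p). weight M * (w p * share M p))"
  define f where "f = (\<lambda>(N, p). (N - {#p#}, p :: 'a))"
  have sub: "set_mset M \<subseteq> X" if "M \<in> shadow B" for M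
    using that B by (fastforce simp: shadow_def dest: in_diffD)
  have fin: "finite (shadow B)"
    using assms(1) by (simp add: shadow_def)
  have inj: "inj_on f (Sigma B set_mset)"
    by (auto simp: inj_on_def f_def) (metis insert_DiffM)
  have "(\<Sum>N\<in>B. weight N) \<le> (\<Sum>N\<in>B. \<Sum>p\<in>set_mset N. pay (f (N, p)))"
  proof (intro sum_mono)
    fix N assume "N \<in> B"
    have "weight N * 1 \<le> weight N * (\<Sum>p\<in>set_mset N. share (N - {#p#}) p)"
      using B[OF \<open>N \<in> B\<close>] weight_pos[of N] by (intro mult_left_mono sum_share_ge_1) auto
    also have "\<dots> = (\<Sum>p\<in>set_mset N. pay (f (N, p)))"
      unfolding sum_distrib_left
    proof (intro sum.cong refl)
      fix p assume "p \<in># N"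
      then obtain M where "N = add_mset p M" by (metis multi_member_split)
      thus "weight N * share (N - {#p#}) p = pay (f (N, p))"
        by (simp add: pay_def f_def weight_def)
    qed
    finally show "weight N \<le> (\<Sum>p\<in>set_mset N. pay (f (N, p)))" by simp
  qed
  also have "\<dots> = (\<Sum>z\<in>Sigma B set_mset. pay (f z))"
    using assms(1) by (subst sum.Sigma) (auto simp: split_def)
  also have "\<dots> = (\<Sum>z\<in>f ` Sigma B set_mset. pay z)"
    by (simp add: sum.reindex[OF inj])
  also have "\<dots> \<le> (\<Sum>z\<in>shadow B \<times> X. pay z)"
  proof (intro sum_mono2)
    show "f ` Sigma B set_mset \<subseteq> shadow B \<times> X"
      using B by (fastforce simp: f_def shadow_def)
  qed (use fin finite_X sub in
    \<open>auto simp: pay_def intro!: mult_nonneg_nonneg share_nonneg weight_nonneg less_imp_le[OF w_pos]\<close>)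
  also have "\<dots> = (\<Sum>M\<in>shadow B. weight M * (\<Sum>p\<in>X. w p * share M p))"
    by (simp add: pay_def sum_distrib_left flip: sum.cartesian_product)
  also have "\<dots> \<le> (\<Sum>M\<in>shadow B. weight M)"
    using sub by (intro sum_mono mult_left_le sum_share_le_1 weight_nonneg)
  finally show ?thesis .
qed

text \<open>
  The induction lowers the maximal size $k+2$ to $k+1$ by passing to the shadow $\partial B$ of the
  top layer $B$.  The family $(A - B) \cup \partial B$ is again an antichain: a member of $A - B$
  below a shadow would lie below a member of $B$, and nothing lies properly above a shadow, since
  shadows now have the maximal size.
\<close>

theorem antichain_weight_le_total:
  assumes "finite A" and "\<And>M. M \<in> A \<Longrightarrow> M \<noteq> {#} \<and> set_mset M \<subseteq> X"
    and "\<And>M N. M \<in> A \<Longrightarrow> N \<in> A \<Longrightarrow> M \<subseteq># N \<Longrightarrow> M = N"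
  shows "(\<Sum>M\<in>A. weight M) \<le> total"
proof -
  define k where "k = Max (insert 0 (size ` A))"
  have "size M \<le> Suc k" if "M \<in> A" for M
    using that assms(1) by (auto simp: k_def intro!: le_SucI Max_ge)
  with assms show ?thesis
  proof (induction k arbitrary: A)
    case 0
    have "A \<subseteq> (\<lambda>p. {#p#}) ` X"
    proof
      fix M assume M: "M \<in> A"
      have "size M = 1"
        using "0.prems"(2,4)[OF M] by (simp add: le_Suc_eq)
      then obtain p where "M = {#p#}" by (metis size_1_singleton_mset)
      thus "M \<in> (\<lambda>p. {#p#}) ` X" using "0.prems"(2)[OF M] by auto
    qed
    hence "(\<Sum>M\<in>A. weight M) \<le> (\<Sum>M\<in>(\<lambda>p. {#p#}) ` X. weight M)"
      using finite_X by (intro sum_mono2) (auto intro!: weight_nonneg)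
    also have "\<dots> = total"
      by (subst sum.reindex) (auto simp: inj_on_def weight_def total_def)
    finally show ?case .
  next
    case (Suc k)
    define B where "B = {M \<in> A. size M = Suc (Suc k)}"
    have B: "finite B" "B \<subseteq> A" "\<And>N. N \<in> B \<Longrightarrow> size N = Suc (Suc k)"
      using Suc.prems(1) by (auto simp: B_def)
    have finA: "finite (A - B)" and finS: "finite (shadow B)"
      using Suc.prems(1) B(1) by (auto simp: shadow_def)
    have shadowE: "\<exists>N\<in>A. M \<subseteq># N \<and> N \<in> B \<and> size M = Suc k" if "M \<in> shadow B" for M
    proof -
      obtain N p where N: "N \<in> B" "p \<in># N" "M = N - {#p#}"
        using \<open>M \<in> shadow B\<close> by (auto simp: shadow_def)
      have "M \<subseteq># N" using N(3) by simp
      moreover have "size M = Suc k" using N B(3) by (simp add: size_Diff_singleton)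
      ultimately show ?thesis using N(1) B(2) by blast
    qed
    have small: "size M \<le> Suc k" if "M \<in> (A - B) \<union> shadow B" for M
      using that Suc.prems(4)[of M] shadowE[of M] by (auto simp: B_def le_Suc_eq)
    have not_below: False if "M \<in> A - B" "N \<in> shadow B" "M \<subseteq># N" for M N
      using that shadowE[of N] Suc.prems(3)[of M] by (metis DiffE subset_mset.order_trans)
    have "(\<Sum>M\<in>A. weight M) = (\<Sum>M\<in>A - B. weight M) + (\<Sum>M\<in>B. weight M)"
      using B(2) Suc.prems(1) by (simp add: sum.subset_diff)
    also have "\<dots> \<le> (\<Sum>M\<in>A - B. weight M) + (\<Sum>M\<in>shadow B. weight M)"
      using B Suc.prems(2) by (intro add_left_mono weight_le_weight_shadow) auto
    also have "\<dots> = (\<Sum>M\<in>(A - B) \<union> shadow B. weight M)"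
      using finA finS not_below by (intro sum.union_disjoint [symmetric]) auto
    also have "\<dots> \<le> total"
    proof (rule Suc.IH)
      show "M \<noteq> {#} \<and> set_mset M \<subseteq> X" if "M \<in> (A - B) \<union> shadow B" for M
      proof (cases "M \<in> shadow B")
        case True
        then obtain N where "N \<in> A" "M \<subseteq># N" "size M = Suc k" using shadowE by blast
        thus ?thesis using Suc.prems(2)[of N] by (auto dest: mset_subset_eqD)
      qed (use that Suc.prems(2) in auto)
      show "M = N" if MN: "M \<in> (A - B) \<union> shadow B" "N \<in> (A - B) \<union> shadow B" "M \<subseteq># N" for M N
      proof (cases "M \<in> shadow B")
        case True
        hence "size N \<le> size M" using small[OF MN(2)] shadowE[of M] by auto
        thus ?thesis using MN(3) by (metis mset_subset_size subset_mset.le_less not_le)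
      next
        case False
        thus ?thesis using MN not_below Suc.prems(3) by auto
      qed
    qed (use finA finS small in auto)
    finally show ?case .
  qed
qed

end

section \<open>Dirichlet sums over primitive sets\<close>

lemma prod_mset_powr:
  "(\<Prod>p\<in>#M. real p powr s) = real (\<Prod>\<^sub># M) powr s"
  by (induction M) (simp_all add: powr_mult)

text \<open>
  Raising the exponent from $1$ to $t$ decreases both $\sum p^{-t}$ and $\sum p^{-2t}$, so it
  preserves an upper bound of the form $1 + \sqrt{1 - \sum p^{-2t}}$ for the former.  If the sum
  of the weights $w_p$ is at least one, squaring this bound gives the condition on pairs; if it is
  smaller, the condition holds because then $h^2 \le h$ and $\sum_p w_p^2 \le h$.
\<close>

lemma pair_bounded_weights_primes:
  fixes P :: "nat set"
  assumes P: "finite P" "\<And>p. p \<in> P \<Longrightarrow> prime p"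
    and bound: "(\<Sum>p\<in>P. 1 / real p) \<le> 1 + sqrt (1 - (\<Sum>p\<in>P. 1 / real p ^ 2))"
    and t: "t \<ge> 1"
  shows "pair_bounded_weights P (\<lambda>p. real p powr -t)"
proof
  define h where "h = (\<Sum>p\<in>P. real p powr -t)"
  define q where "q = (\<Sum>p\<in>P. (real p powr -t)\<^sup>2)"
  have p2: "real p \<ge> 2" if "p \<in> P" for p
    using prime_ge_2_nat[OF P(2)[OF that]] by simp
  show "finite P" by fact
  show "real p powr -t > 0" if "p \<in> P" for p
    using p2[OF that] by simp
  have le: "real p powr -t \<le> 1 / real p" if "p \<in> P" for p
  proof -
    have "real p powr -t \<le> real p powr -1"
      using p2[OF that] t by (intro powr_mono) auto
    thus ?thesis using p2[OF that] by (simp add: powr_minus_divide)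
  qed
  have "1 - q \<ge> 0"
  proof -
    have "q \<le> (\<Sum>p\<in>P. 1 / real p ^ 2)"
      unfolding q_def using le
      by (intro sum_mono) (metis power_mono powr_ge_zero power_one_over)
    also have "\<dots> < 1"
      using sum_inverse_prime_squares(2)[of P] P by simp
    finally show ?thesis by simp
  qed
  have "h \<le> (\<Sum>p\<in>P. 1 / real p)"
    unfolding h_def using le by (intro sum_mono)
  also have "\<dots> \<le> 1 + sqrt (1 - (\<Sum>p\<in>P. 1 / real p ^ 2))" by (rule bound)
  also have "\<dots> \<le> 1 + sqrt (1 - q)"
    unfolding q_def using le
    by (intro add_left_mono real_sqrt_le_mono diff_left_mono sum_mono)
       (metis power_mono powr_ge_zero power_one_over)
  finally have h_le: "h - 1 \<le> sqrt (1 - q)" by simp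
  have "h\<^sup>2 + q \<le> 2 * h"
  proof (cases "h \<ge> 1")
    case True
    hence "(h - 1)\<^sup>2 \<le> (sqrt (1 - q))\<^sup>2"
      using h_le by (intro power_mono) auto
    thus ?thesis using \<open>1 - q \<ge> 0\<close> by (simp add: power2_eq_square algebra_simps)
  next
    case False
    have "h \<ge> 0" unfolding h_def by (intro sum_nonneg) simp
    hence "h\<^sup>2 \<le> h" using False by (simp add: power2_eq_square mult_left_le)
    moreover have "q \<le> h"
      unfolding q_def h_def power2_eq_square
    proof (intro sum_mono mult_left_le)
      fix p assume "p \<in> P"
      thus "real p powr -t \<le> 1"
        using le[of p] p2[of p] by (auto intro: order_trans)
    qed simp
    ultimately show ?thesis by linarith
  qed
  thus "(\<Sum>p\<in>P. real p powr -t)\<^sup>2 + (\<Sum>p\<in>P. (real p powr -t)\<^sup>2) \<le> 2 * (\<Sum>p\<in>P. real p powr -t)"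
    by (simp add: h_def q_def)
qed

lemma sum_powr_primitive_le:
  fixes P F :: "nat set"
  assumes P: "finite P" "\<And>p. p \<in> P \<Longrightarrow> prime p"
    and bound: "(\<Sum>p\<in>P. 1 / real p) \<le> 1 + sqrt (1 - (\<Sum>p\<in>P. 1 / real p ^ 2))"
    and t: "t \<ge> 1"
    and F: "finite F" "F \<subseteq> nat_over P" "1 \<notin> F"
    and prim: "\<And>a b. a \<in> F \<Longrightarrow> b \<in> F \<Longrightarrow> a dvd b \<Longrightarrow> a = b"
  shows "(\<Sum>n\<in>F. real n powr -t) \<le> (\<Sum>p\<in>P. real p powr -t)"
proof -
  interpret pair_bounded_weights P "\<lambda>p. real p powr -t"
    using P bound t by (rule pair_bounded_weights_primes)
  have pos: "n > 0" if "n \<in> F" for n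
    using that F(2) by (auto simp: nat_over_def)
  have inj: "inj_on prime_factorization F"
  proof (rule inj_onI)
    fix a b assume ab: "a \<in> F" "b \<in> F" "prime_factorization a = prime_factorization b"
    thus "a = b" using pos by (metis prod_mset_prime_factorization_nat)
  qed
  have "(\<Sum>n\<in>F. real n powr -t) = (\<Sum>n\<in>F. weight (prime_factorization n))"
    using pos by (intro sum.cong) (auto simp: weight_def prod_mset_powr prod_mset_prime_factorization_nat)
  also have "\<dots> = (\<Sum>M\<in>prime_factorization ` F. weight M)"
    by (simp add: sum.reindex[OF inj])
  also have "\<dots> \<le> total"
  proof (rule antichain_weight_le_total)
    show "finite (prime_factorization ` F)" using F(1) by simp
  next
    fix M assume "M \<in> prime_factorization ` F"
    then obtain n where n: "n \<in> F" "M = prime_factorization n" by auto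
    have "M \<noteq> {#}"
      using n pos[of n] F(3) by (auto simp: prime_factorization_empty_iff)
    moreover have "set_mset M \<subseteq> P"
      using n F(2) by (auto simp: nat_over_def in_prime_factors_iff)
    ultimately show "M \<noteq> {#} \<and> set_mset M \<subseteq> P" ..
  next
    fix M N assume "M \<in> prime_factorization ` F" "N \<in> prime_factorization ` F" and MN: "M \<subseteq># N"
    then obtain a b where ab: "a \<in> F" "b \<in> F" "M = prime_factorization a" "N = prime_factorization b"
      by auto
    hence "a dvd b" using MN pos by (simp add: prime_factorization_subset_iff_dvd)
    thus "M = N" using prim ab by auto
  qed
  finally show ?thesis by (simp add: total_def)
qed

section \<open>From Dirichlet sums to the sum of 1/(n log n)\<close>

text \<open>
  The integral over $t$ from $1$ to infinity appears as a primitive: the function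
  $G(t) = \sum_B n^{-t}/\log n - \sum_A n^{-t}/\log n$ is nonincreasing and tends to zero, so
  it is nonnegative at $t = 1$.
\<close>

lemma sum_inverse_n_ln_le:
  fixes A B :: "nat set"
  assumes A: "finite A" "\<And>n. n \<in> A \<Longrightarrow> n \<ge> 2" and B: "finite B" "\<And>n. n \<in> B \<Longrightarrow> n \<ge> 2"
    and le: "\<And>t. t \<ge> 1 \<Longrightarrow> (\<Sum>n\<in>A. real n powr -t) \<le> (\<Sum>n\<in>B. real n powr -t)"
  shows "(\<Sum>n\<in>A. 1 / (real n * ln (real n))) \<le> (\<Sum>n\<in>B. 1 / (real n * ln (real n)))"
proof -
  define g where "g C t = (\<Sum>n\<in>C. real n powr -t / ln (real n))" for C :: "nat set" and t
  have deriv: "(g C has_real_derivative - (\<Sum>n\<in>C. real n powr -t)) (at t)"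
    if "\<And>n. n \<in> C \<Longrightarrow> n \<ge> 2" for C t
  proof -
    have "(g C has_real_derivative (\<Sum>n\<in>C. - (real n powr -t))) (at t)"
      unfolding g_def
    proof (rule DERIV_sum)
      fix n assume "n \<in> C"
      hence "real n \<ge> 2" using that by fastforce
      thus "((\<lambda>t. real n powr -t / ln (real n)) has_real_derivative - (real n powr -t)) (at t)"
        by (auto intro!: derivative_eq_intros simp: powr_def)
    qed
    thus ?thesis by (simp add: sum_negf)
  qed
  have lim: "(g C \<longlongrightarrow> 0) at_top" if "\<And>n. n \<in> C \<Longrightarrow> n \<ge> 2" for C
  proof -
    have "(g C \<longlongrightarrow> (\<Sum>n\<in>C. 0)) at_top"
      unfolding g_def
    proof (rule tendsto_sum)
      fix n assume "n \<in> C"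
      hence "real n > 1" using that by fastforce
      hence "((\<lambda>t. real n powr -t) \<longlongrightarrow> 0) at_top"
        by real_asymp
      thus "((\<lambda>t. real n powr -t / ln (real n)) \<longlongrightarrow> 0) at_top"
        by (rule tendsto_divide_zero)
    qed
    thus ?thesis by simp
  qed
  define G where "G t = g B t - g A t" for t
  have "(G \<longlongrightarrow> 0 - 0) at_top"
    unfolding G_def using A B by (intro tendsto_diff lim)
  moreover have "G t \<le> G 1" if "t \<ge> 1" for t
  proof (rule DERIV_nonpos_imp_nonincreasing[OF that])
    fix x :: real assume "1 \<le> x"
    have "(G has_real_derivative - (\<Sum>n\<in>B. real n powr -x) - - (\<Sum>n\<in>A. real n powr -x)) (at x)"
      unfolding G_def using A B by (intro DERIV_diff deriv)
    thus "\<exists>y. (G has_real_derivative y) (at x) \<and> y \<le> 0"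
      using le[OF \<open>1 \<le> x\<close>] by (intro exI conjI) auto
  qed
  hence "\<forall>\<^sub>F t in at_top. G t \<le> G 1"
    using eventually_ge_at_top by (rule eventually_mono[rotated])
  ultimately have "0 \<le> G 1"
    using tendsto_upperbound[of G 0 at_top "G 1"] by simp
  moreover have "g C 1 = (\<Sum>n\<in>C. 1 / (real n * ln (real n)))" for C
    unfolding g_def by (intro sum.cong) (auto simp: powr_minus_divide)
  ultimately show ?thesis by (simp add: G_def)
qed

section \<open>Primitive sets over a thin set of primes\<close>

lemma ennreal_sum_le_infsum:
  fixes f :: "'a \<Rightarrow> ennreal"
  assumes "finite F" "F \<subseteq> A"
  shows "sum f F \<le> infsum f A"
proof -
  have "infsum f F \<le> infsum f A"
    using assms by (intro infsum_mono_neutral nonneg_summable_on_complete) auto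
  thus ?thesis using assms by simp
qed

theorem theorem3:
  fixes P S :: "nat set"
  assumes "\<forall>p\<in>P. prime p"
    and "(\<Sum>\<^sub>\<infinity>p\<in>P. ennreal (1 / real p)) \<le> ennreal (1 + sqrt (1 - (\<Sum>\<^sub>\<infinity>p\<in>P. 1 / real p ^ 2)))"
    and "primitive_set S"
    and "S \<subseteq> nat_over P"
  shows "(\<Sum>\<^sub>\<infinity>n\<in>S. ennreal (1 / (real n * ln (real n))))
           \<le> (\<Sum>\<^sub>\<infinity>p\<in>P. ennreal (1 / (real p * ln (real p))))"
proof (rule infsum_le_finite_sums[OF nonneg_summable_on_complete])
  fix F assume F: "finite F" "F \<subseteq> S"
  \<comment> \<open>Only finitely many primes divide members of \<open>F\<close>, and passing from \<open>P\<close> to these lowers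
      the left side of the hypothesis and raises the right side.\<close>
  define Q where "Q = (\<Union>n\<in>F. prime_factors n)"
  have pos: "n > 0" if "n \<in> F" for n
    using that F(2) assms(4) by (auto simp: nat_over_def)
  have QP: "Q \<subseteq> P"
    using F(2) assms(4) by (auto simp: Q_def nat_over_def in_prime_factors_iff subset_iff)
  have fin: "finite Q" using F(1) by (simp add: Q_def)
  have primeQ: "prime p" if "p \<in> Q" for p
    using that by (auto simp: Q_def in_prime_factors_iff)
  have ge2: "n \<ge> 2" if "n \<in> F" for n
  proof -
    have "n \<noteq> 1" using that F(2) primitive_set_not_1[OF assms(3)] by auto
    thus ?thesis using pos[OF that] by linarith
  qed
  have nonneg: "1 / (real n * ln (real n)) \<ge> 0" for n :: nat
    by (cases "n = 0") (auto intro!: divide_nonneg_nonneg mult_nonneg_nonneg)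
  note squares = sum_inverse_prime_squares[OF assms(1)]
  have "ennreal (\<Sum>p\<in>Q. 1 / real p) = (\<Sum>p\<in>Q. ennreal (1 / real p))"
    by (simp add: sum_ennreal)
  also have "\<dots> \<le> (\<Sum>\<^sub>\<infinity>p\<in>P. ennreal (1 / real p))"
    using fin QP by (rule ennreal_sum_le_infsum)
  also note assms(2)
  finally have "(\<Sum>p\<in>Q. 1 / real p) \<le> 1 + sqrt (1 - (\<Sum>\<^sub>\<infinity>p\<in>P. 1 / real p ^ 2))"
    using squares(2) by (subst (asm) ennreal_le_iff) auto
  also have "\<dots> \<le> 1 + sqrt (1 - (\<Sum>p\<in>Q. 1 / real p ^ 2))"
    using finite_sum_le_infsum[OF squares(1) fin QP] by simp
  finally have bound: "(\<Sum>p\<in>Q. 1 / real p) \<le> 1 + sqrt (1 - (\<Sum>p\<in>Q. 1 / real p ^ 2))" .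
  have "(\<Sum>n\<in>F. 1 / (real n * ln (real n))) \<le> (\<Sum>p\<in>Q. 1 / (real p * ln (real p)))"
  proof (rule sum_inverse_n_ln_le)
    fix t :: real assume "t \<ge> 1"
    show "(\<Sum>n\<in>F. real n powr -t) \<le> (\<Sum>p\<in>Q. real p powr -t)"
    proof (rule sum_powr_primitive_le[OF fin primeQ bound \<open>t \<ge> 1\<close> F(1)])
      show "F \<subseteq> nat_over Q"
        using pos by (auto simp: nat_over_def Q_def in_prime_factors_iff)
    next
      show "a = b" if "a \<in> F" "b \<in> F" "a dvd b" for a b
        using that F(2) assms(3) by (auto simp: primitive_set_def)
    qed (use ge2 in force)+
  qed (use F(1) fin ge2 primeQ prime_ge_2_nat in auto)
  hence "ennreal (\<Sum>n\<in>F. 1 / (real n * ln (real n))) \<le> ennreal (\<Sum>p\<in>Q. 1 / (real p * ln (real p)))"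
    by (rule ennreal_leI)
  hence "(\<Sum>n\<in>F. ennreal (1 / (real n * ln (real n)))) \<le> (\<Sum>p\<in>Q. ennreal (1 / (real p * ln (real p))))"
    using nonneg by (simp add: sum_ennreal)
  also have "\<dots> \<le> (\<Sum>\<^sub>\<infinity>p\<in>P. ennreal (1 / (real p * ln (real p))))"
    using fin QP by (rule ennreal_sum_le_infsum)
  finally show "(\<Sum>n\<in>F. ennreal (1 / (real n * ln (real n))))
      \<le> (\<Sum>\<^sub>\<infinity>p\<in>P. ennreal (1 / (real p * ln (real p))))" .
qed auto

end
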